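(* Let $\mathfrak{A}$ be a $C^*$-algebra with identity $e$ and let $c\in\mathcal{Z}(\mathfrak{A})\cap\mathcal{U}(\mathfrak{A})$. Then for every $x,y\in\mathfrak{A}$ the following statements are equivalent: (i) $x\parallel_v y$. (ii) $cx\parallel_v cy$. (iii) $xc\parallel_v yc$.
   Context: $\mathfrak{A}$ is a (nonzero, complex) $C^*$-algebra with unit $e$; $\mathcal{Z}(\mathfrak{A})$ is its centre and $\mathcal{U}(\mathfrak{A})$ its group of unitary elements. The set of normalized states is $\mathcal{S}(\mathfrak{A})=\{\varphi\in\mathfrak{A}':\varphi(e)=\|\varphi\|=1\}$, where $\mathfrak{A}'$ is the dual space of $\mathfrak{A}$. The numerical radius of $x$ is $v(x)=\sup\{|\varphi(x)|:\varphi\in\mathcal{S}(\mathfrak{A})\}$. An element $x\in\mathfrak{A}$ is numerical radius parallel to $y\in\mathfrak{A}$, written $x\parallel_v y$, if $v(x+\lambda y)=v(x)+v(y)$ for some $\lambda\in\mathbb{C}$ with $|\lambda|=1$. *)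

theory Defs
  imports "HOL-Analysis.Analysis"
begin

text \<open>Unital C*-algebras as a type class. Nonzeroness is the class axiom \<open>0 \<noteq> 1\<close>, and
  submultiplicativity of the norm and completeness come from the library classes; that the
  unit has norm 1 is derived below.\<close>

class unital_cstar_algebra = real_algebra_1 + real_normed_algebra + complete_space +
  fixes scaleC :: "complex \<Rightarrow> 'a \<Rightarrow> 'a" (infixr "*\<^sub>C" 75)
    and star :: "'a \<Rightarrow> 'a"
  assumes scaleC_add_right: "a *\<^sub>C (x + y) = a *\<^sub>C x + a *\<^sub>C y"
    and scaleC_add_left: "(a + b) *\<^sub>C x = a *\<^sub>C x + b *\<^sub>C x"
    and scaleC_scaleC: "a *\<^sub>C b *\<^sub>C x = (a * b) *\<^sub>C x"
    and scaleC_of_real: "complex_of_real r *\<^sub>C x = r *\<^sub>R x"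
    and norm_scaleC: "norm (a *\<^sub>C x) = cmod a * norm x"
    and mult_scaleC_left: "(a *\<^sub>C x) * y = a *\<^sub>C (x * y)"
    and mult_scaleC_right: "x * (a *\<^sub>C y) = a *\<^sub>C (x * y)"
    and star_star: "star (star x) = x"
    and star_add: "star (x + y) = star x + star y"
    and star_scaleC: "star (a *\<^sub>C x) = cnj a *\<^sub>C star x"
    and star_mult: "star (x * y) = star y * star x"
    and cstar_identity: "norm (star x * x) = (norm x)\<^sup>2"
begin

lemma star_one: "star 1 = 1"
  by (metis mult.left_neutral mult.right_neutral star_mult star_star)

subclass real_normed_algebra_1
proof
  have "norm (1::'a) = norm (1::'a) * norm (1::'a)"
    using cstar_identity[of 1] by (simp add: star_one monoid_mult_class.power2_eq_square)
  then show "norm (1::'a) = 1"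
    by simp
qed

subclass banach ..

end

instantiation complex :: unital_cstar_algebra
begin

definition "scaleC_complex = ((*) :: complex \<Rightarrow> complex \<Rightarrow> complex)"
definition "star_complex = cnj"

instance
  by standard
    (simp_all add: scaleC_complex_def star_complex_def ring_distribs mult_ac scaleR_conv_of_real
      norm_mult power2_eq_square)

end

definition algebra_centre :: "'a::unital_cstar_algebra set" where
  "algebra_centre = {z. \<forall>x. z * x = x * z}"

definition unitary_group :: "'a::unital_cstar_algebra set" where
  "unitary_group = {u. star u * u = 1 \<and> u * star u = 1}"

definition dual_space :: "('a::unital_cstar_algebra \<Rightarrow> complex) set" where
  "dual_space = {\<phi>. bounded_linear \<phi> \<and> (\<forall>a x. \<phi> (a *\<^sub>C x) = a * \<phi> x)}"

definition states :: "('a::unital_cstar_algebra \<Rightarrow> complex) set" where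
  "states = {\<phi> \<in> dual_space. \<phi> 1 = 1 \<and> onorm \<phi> = 1}"

text \<open>The supremum below is a genuine one: there are states by the Hahn-Banach theorem, and
  \<open>cmod (\<phi> x) \<le> norm x\<close> for each of them.\<close>

definition numerical_radius :: "'a::unital_cstar_algebra \<Rightarrow> real" where
  "numerical_radius x = (SUP \<phi>\<in>states. cmod (\<phi> x))"

definition numerical_radius_parallel :: "'a::unital_cstar_algebra \<Rightarrow> 'a \<Rightarrow> bool"
    (infix "\<parallel>\<^sub>v" 50) where
  "x \<parallel>\<^sub>v y \<longleftrightarrow>
    (\<exists>\<mu>::complex. cmod \<mu> = 1 \<and>
      numerical_radius (x + \<mu> *\<^sub>C y) = numerical_radius x + numerical_radius y)"

end

theory Submission
  imports Defs
begin

text \<open>It suffices that the numerical radius \<open>v\<close> is invariant under multiplication by a central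
  unitary \<open>c\<close>. Evaluating Fejer kernels at \<open>c\<close> gives positive Laurent polynomials
  \<open>f\<^sub>0, \<dots>, f\<^sub>N\<^sub>-\<^sub>1\<close> in \<open>c\<close> with \<open>\<Sum>\<^sub>m f\<^sub>m = 1\<close> and \<open>c \<approx> \<Sum>\<^sub>m w\<^sub>m f\<^sub>m\<close> for the \<open>N\<close>-th roots of
  unity \<open>w\<^sub>m\<close>. For a state \<open>\<phi>\<close>, each nonzero functional \<open>\<phi> (f\<^sub>m \<cdot>)\<close> is a multiple of a state, and the
  factors have absolute sum at most 1. Hence \<open>\<bar>\<phi> (c x)\<bar>\<close> is bounded by \<open>v(x)\<close> up to an error that vanishes as
  \<open>N \<rightarrow> \<infinity>\<close>. Spectral theory is avoided by the inequality
  \<open>\<parallel>F(c)\<parallel> \<le> sup {\<parallel>F(z)\<parallel> : \<bar>z\<bar> = 1}\<close> for polynomials \<open>F\<close> with coefficients in the algebra.\<close>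

section \<open>Complex scalars and the involution\<close>

lemma scaleC_one [simp]: "1 *\<^sub>C (x::'a::unital_cstar_algebra) = x"
  using scaleC_of_real[of 1 x] by simp

lemma scaleC_zero_left [simp]: "0 *\<^sub>C (x::'a::unital_cstar_algebra) = 0"
  using scaleC_of_real[of 0 x] by simp

lemma scaleC_zero_right [simp]: "a *\<^sub>C (0::'a::unital_cstar_algebra) = 0"
  using scaleC_add_right[of a 0 "0::'a"] by simp

lemma scaleC_minus_left: "(- a) *\<^sub>C (x::'a::unital_cstar_algebra) = - (a *\<^sub>C x)"
  using scaleC_add_left[of "- a" a x] by (simp add: eq_neg_iff_add_eq_0)

lemma scaleC_diff_left: "(a - b) *\<^sub>C (x::'a::unital_cstar_algebra) = a *\<^sub>C x - b *\<^sub>C x"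
  using scaleC_add_left[of a "- b" x] by (simp add: scaleC_minus_left)

lemma scaleC_sum_right: "a *\<^sub>C (\<Sum>i\<in>A. f i) = (\<Sum>i\<in>A. a *\<^sub>C (f i :: 'a::unital_cstar_algebra))"
  by (induction A rule: infinite_finite_induct) (auto simp: scaleC_add_right)

lemma scaleC_sum_left: "(\<Sum>i\<in>A. f i) *\<^sub>C (x::'a::unital_cstar_algebra) = (\<Sum>i\<in>A. f i *\<^sub>C x)"
  by (induction A rule: infinite_finite_induct) (auto simp: scaleC_add_left)

lemma star_zero [simp]: "star (0::'a::unital_cstar_algebra) = 0"
  using star_add[of 0 "0::'a"] by simp

lemma star_sum: "star (\<Sum>i\<in>A. f i) = (\<Sum>i\<in>A. star (f i :: 'a::unital_cstar_algebra))"
  by (induction A rule: infinite_finite_induct) (auto simp: star_add)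

lemma star_power: "star ((x::'a::unital_cstar_algebra) ^ n) = star x ^ n"
  by (induction n) (auto simp: star_one star_mult power_commutes)

section \<open>Central unitaries\<close>

abbreviation central_unitary :: "'a::unital_cstar_algebra \<Rightarrow> bool" where
  "central_unitary c \<equiv> c \<in> algebra_centre \<inter> unitary_group"

lemma central_unitaryD:
  assumes "central_unitary c"
  shows "c * x = x * c" "star c * c = 1" "c * star c = 1"
  using assms unfolding algebra_centre_def unitary_group_def by blast+

lemma central_unitary_star:
  assumes "central_unitary (c::'a::unital_cstar_algebra)"
  shows "central_unitary (star c)"
proof -
  have "star c * x = x * star c" for x
  proof -
    have "star (star c * x) = star (x * star c)"
      using central_unitaryD(1)[OF assms, of "star x"] by (simp add: star_mult star_star)
    then show ?thesis
      by (metis star_star)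
  qed
  moreover have "star (star c) * star c = 1" "star c * star (star c) = 1"
    by (simp_all add: star_star central_unitaryD(2,3)[OF assms])
  ultimately show ?thesis
    unfolding algebra_centre_def unitary_group_def by blast
qed

lemma central_unitary_mult:
  assumes "central_unitary (c::'a::unital_cstar_algebra)" "central_unitary d"
  shows "central_unitary (c * d)"
proof -
  have "c * d * x = x * (c * d)" for x
    using central_unitaryD(1)[OF assms(1)] central_unitaryD(1)[OF assms(2)]
    by (metis mult.assoc)
  moreover have "star (c * d) * (c * d) = 1"
  proof -
    have "star (c * d) * (c * d) = star d * (star c * c) * d"
      by (simp only: star_mult mult.assoc)
    then show ?thesis
      by (simp add: central_unitaryD(2)[OF assms(1)] central_unitaryD(2)[OF assms(2)])
  qed
  moreover have "c * d * star (c * d) = 1"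
  proof -
    have "c * d * star (c * d) = c * (d * star d) * star c"
      by (simp only: star_mult mult.assoc)
    then show ?thesis
      by (simp add: central_unitaryD(3)[OF assms(1)] central_unitaryD(3)[OF assms(2)])
  qed
  ultimately show ?thesis
    unfolding algebra_centre_def unitary_group_def by blast
qed

lemma central_unitary_power:
  assumes "central_unitary (c::'a::unital_cstar_algebra)"
  shows "central_unitary (c ^ n)"
proof (induction n)
  case 0
  then show ?case
    by (auto simp: algebra_centre_def unitary_group_def star_one)
next
  case (Suc n)
  then show ?case
    using central_unitary_mult[OF assms] by simp
qed

lemma norm_central_unitary_mult:
  assumes "central_unitary (c::'a::unital_cstar_algebra)"
  shows "norm (c * x) = norm x"
proof -
  have "star (c * x) * (c * x) = star x * x"
    using central_unitaryD(2)[OF assms] by (metis mult.assoc mult_1_left star_mult)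
  then have "(norm (c * x))\<^sup>2 = (norm x)\<^sup>2"
    by (metis cstar_identity)
  then show ?thesis
    by simp
qed

section \<open>Algebra-valued polynomials evaluated at a central unitary\<close>

text \<open>\<open>T = F(c)\<close> for a polynomial \<open>F\<close> of degree at most \<open>d\<close> with coefficients in the algebra; only the
  values of \<open>F\<close> on the unit circle matter.\<close>

definition poly_rep :: "'a::unital_cstar_algebra \<Rightarrow> nat \<Rightarrow> (complex \<Rightarrow> 'a) \<Rightarrow> 'a \<Rightarrow> bool" where
  "poly_rep c d F T \<longleftrightarrow> (\<exists>y. T = (\<Sum>j\<le>d. c ^ j * y j) \<and>
     (\<forall>z. cmod z = 1 \<longrightarrow> F z = (\<Sum>j\<le>d. z ^ j *\<^sub>C y j)))"

lemma poly_rep_cong: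
  assumes "poly_rep c d F T" "\<And>z. cmod z = 1 \<Longrightarrow> F z = G z" "T = S"
  shows "poly_rep c d G S"
  using assms unfolding poly_rep_def by auto

lemma poly_rep_monomial:
  assumes "k \<le> d"
  shows "poly_rep c d (\<lambda>z. z ^ k *\<^sub>C y) (c ^ k * y)"
  unfolding poly_rep_def
proof (intro exI conjI allI impI)
  have *: "(\<Sum>j\<le>d. if j = k then c ^ j * y else 0) = c ^ k * y"
    using assms by simp
  show "c ^ k * y = (\<Sum>j\<le>d. c ^ j * (if j = k then y else 0))"
    unfolding *[symmetric] by (intro sum.cong) auto
  fix z
  have *: "(\<Sum>j\<le>d. if j = k then z ^ j *\<^sub>C y else 0) = z ^ k *\<^sub>C y"
    using assms by simp
  show "z ^ k *\<^sub>C y = (\<Sum>j\<le>d. z ^ j *\<^sub>C (if j = k then y else 0))"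
    unfolding *[symmetric] by (intro sum.cong) auto
qed

lemma poly_rep_add:
  assumes "poly_rep c d F T" "poly_rep c d G S"
  shows "poly_rep c d (\<lambda>z. F z + G z) (T + S)"
proof -
  obtain y where y: "T = (\<Sum>j\<le>d. c ^ j * y j)" "\<forall>z. cmod z = 1 \<longrightarrow> F z = (\<Sum>j\<le>d. z ^ j *\<^sub>C y j)"
    using assms(1) unfolding poly_rep_def by blast
  obtain x where x: "S = (\<Sum>j\<le>d. c ^ j * x j)" "\<forall>z. cmod z = 1 \<longrightarrow> G z = (\<Sum>j\<le>d. z ^ j *\<^sub>C x j)"
    using assms(2) unfolding poly_rep_def by blast
  show ?thesis
    unfolding poly_rep_def using x y
    by (intro exI[of _ "\<lambda>j. y j + x j"]) (auto simp: sum.distrib scaleC_add_right distrib_left)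
qed

lemma poly_rep_sum:
  assumes "\<And>i. i \<in> A \<Longrightarrow> poly_rep c d (F i) (T i)"
  shows "poly_rep c d (\<lambda>z. \<Sum>i\<in>A. F i z) (\<Sum>i\<in>A. T i)"
  using assms
proof (induction A rule: infinite_finite_induct)
  case (insert i A)
  then show ?case
    by (simp add: poly_rep_add)
qed (use poly_rep_monomial[of 0 d c 0] in auto)

lemma poly_rep_mono:
  assumes "poly_rep c d F T" "d \<le> e"
  shows "poly_rep c e F T"
proof -
  obtain y where y: "T = (\<Sum>j\<le>d. c ^ j * y j)" "\<forall>z. cmod z = 1 \<longrightarrow> F z = (\<Sum>j\<le>d. z ^ j *\<^sub>C y j)"
    using assms(1) unfolding poly_rep_def by blast
  have "poly_rep c e (\<lambda>z. \<Sum>j\<le>d. z ^ j *\<^sub>C y j) (\<Sum>j\<le>d. c ^ j * y j)"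
    using assms(2) by (intro poly_rep_sum poly_rep_monomial) auto
  then show ?thesis
    by (rule poly_rep_cong) (use y in auto)
qed

text \<open>Powers of \<open>c\<close> commute with the coefficients, so evaluation at
  \<open>c\<close> respects products just as evaluation at a scalar does.\<close>

lemma poly_rep_mult:
  assumes c: "central_unitary c" and "poly_rep c d F T" "poly_rep c e G S"
  shows "poly_rep c (d + e) (\<lambda>z. F z * G z) (T * S)"
proof -
  obtain y where y: "T = (\<Sum>j\<le>d. c ^ j * y j)" "\<forall>z. cmod z = 1 \<longrightarrow> F z = (\<Sum>j\<le>d. z ^ j *\<^sub>C y j)"
    using assms(2) unfolding poly_rep_def by blast
  obtain x where x: "S = (\<Sum>j\<le>e. c ^ j * x j)" "\<forall>z. cmod z = 1 \<longrightarrow> G z = (\<Sum>j\<le>e. z ^ j *\<^sub>C x j)"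
    using assms(3) unfolding poly_rep_def by blast
  have "poly_rep c (d + e) (\<lambda>z. \<Sum>i\<le>d. \<Sum>j\<le>e. z ^ (i + j) *\<^sub>C (y i * x j))
          (\<Sum>i\<le>d. \<Sum>j\<le>e. c ^ (i + j) * (y i * x j))"
    by (intro poly_rep_sum poly_rep_monomial) auto
  then show ?thesis
  proof (rule poly_rep_cong)
    fix z :: complex assume "cmod z = 1"
    then show "(\<Sum>i\<le>d. \<Sum>j\<le>e. z ^ (i + j) *\<^sub>C (y i * x j)) = F z * G z"
      by (simp add: x y sum_product mult_scaleC_left mult_scaleC_right scaleC_scaleC power_add mult.commute)
  next
    have "c ^ (i + j) * (y i * x j) = c ^ i * y i * (c ^ j * x j)" for i j
    proof -
      have "c ^ (i + j) * (y i * x j) = c ^ i * (c ^ j * y i) * x j"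
        by (simp only: power_add mult.assoc)
      also have "c ^ j * y i = y i * c ^ j"
        by (rule central_unitaryD(1)[OF central_unitary_power[OF c]])
      finally show ?thesis
        by (simp only: mult.assoc)
    qed
    then show "(\<Sum>i\<le>d. \<Sum>j\<le>e. c ^ (i + j) * (y i * x j)) = T * S"
      by (simp add: x y sum_product)
  qed
qed

lemma poly_rep_const: "poly_rep c 0 (\<lambda>z. x) x"
  using poly_rep_monomial[of 0 0 c x] by simp

lemma poly_rep_scaleC:
  assumes "central_unitary c" "poly_rep c d F T"
  shows "poly_rep c d (\<lambda>z. a *\<^sub>C F z) (a *\<^sub>C T)"
proof -
  \<comment> \<open>Scaling is treated as multiplication by a constant polynomial of degree
    0.\<close>
  have "poly_rep c (0 + d) (\<lambda>z. a *\<^sub>C 1 * F z) (a *\<^sub>C 1 * T)"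
    by (intro poly_rep_mult assms poly_rep_const)
  then show ?thesis
    by (simp only: mult_scaleC_left mult_1_left add_0_left)
qed

text \<open>On the circle \<open>cnj z\<close> inverts \<open>z\<close>, and \<open>star c\<close>
  inverts \<open>c\<close>, so the involution turns an exponent \<open>j\<close> into
  \<open>- j\<close>. The factor with exponent \<open>d\<close> shifts it to \<open>d - j\<close>
  and restores a polynomial.\<close>

lemma poly_rep_star:
  assumes c: "central_unitary c" and "poly_rep c d F T"
  shows "poly_rep c d (\<lambda>z. z ^ d *\<^sub>C star (F z)) (c ^ d * star T)"
proof -
  obtain y where y: "T = (\<Sum>j\<le>d. c ^ j * y j)" "\<forall>z. cmod z = 1 \<longrightarrow> F z = (\<Sum>j\<le>d. z ^ j *\<^sub>C y j)"
    using assms(2) unfolding poly_rep_def by blast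
  have "poly_rep c d (\<lambda>z. \<Sum>j\<le>d. z ^ (d - j) *\<^sub>C star (y j)) (\<Sum>j\<le>d. c ^ (d - j) * star (y j))"
    by (intro poly_rep_sum poly_rep_monomial) auto
  then show ?thesis
  proof (rule poly_rep_cong)
    fix z :: complex assume z: "cmod z = 1"
    have "z ^ (d - j) = z ^ d * cnj z ^ j" if "j \<le> d" for j
    proof -
      have "z ^ d = z ^ (d - j) * z ^ j"
        using that by (simp add: power_add[symmetric])
      moreover have "z ^ j * cnj z ^ j = 1"
        using z by (simp add: power_mult_distrib[symmetric] complex_norm_square[symmetric])
      ultimately show ?thesis
        by (simp add: mult.assoc)
    qed
    then show "(\<Sum>j\<le>d. z ^ (d - j) *\<^sub>C star (y j)) = z ^ d *\<^sub>C star (F z)"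
      using z by (simp add: y star_sum star_scaleC scaleC_sum_right scaleC_scaleC)
  next
    have "c ^ (d - j) * star (y j) = c ^ d * star (c ^ j * y j)" if "j \<le> d" for j
    proof -
      have "c ^ d = c ^ (d - j) * c ^ j"
        using that by (simp add: power_add[symmetric])
      moreover have "c ^ j * star (c ^ j * y j) = star (y j)"
      proof -
        have "star (c ^ j * y j) = star (c ^ j) * star (y j)"
          using central_unitaryD(1)[OF central_unitary_power[OF c, of j]] by (metis star_mult)
        then show ?thesis
          using central_unitaryD(3)[OF central_unitary_power[OF c, of j]]
          by (metis mult.assoc mult_1_left)
      qed
      ultimately show ?thesis
        by (simp add: mult.assoc)
    qed
    then show "(\<Sum>j\<le>d. c ^ (d - j) * star (y j)) = c ^ d * star T"
      by (simp add: y star_sum sum_distrib_left)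
  qed
qed

section \<open>Norm estimates from values on the unit circle\<close>

lemma sum_roots_of_unity_power:
  fixes k l N :: nat
  assumes "k < N" "l < N"
  defines "w \<equiv> \<lambda>m. cis (2 * pi * real m / real N)"
  shows "(\<Sum>m<N. w m ^ k * cnj (w m) ^ l) = (if k = l then of_nat N else 0)"
proof (cases "k = l")
  case True
  have "w m ^ k * cnj (w m) ^ k = 1" for m
    by (simp add: w_def power_mult_distrib[symmetric] complex_norm_square[symmetric])
  then show ?thesis
    using True by simp
next
  case False
  \<comment> \<open>The ratio of the geometric series that the sum over \<open>m\<close>
    becomes.\<close>
  define q where "q = cis (2 * pi * (real k - real l) / real N)"
  have "w m ^ k * cnj (w m) ^ l = q ^ m" for m
    by (simp add: w_def q_def cis_cnj Complex.DeMoivre cis_mult) (simp add: algebra_simps diff_divide_distrib)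
  moreover have "q ^ N = 1"
  proof -
    have "q ^ N = cis (2 * pi * real_of_int (int k - int l))"
      using assms by (simp add: q_def Complex.DeMoivre)
    then show ?thesis
      by (simp only: cis_multiple_2pi Ints_of_int)
  qed
  \<comment> \<open>Otherwise \<open>N\<close> would divide \<open>int k - int l\<close>, which is
    impossible for distinct exponents below \<open>N\<close>.\<close>
  moreover have "q \<noteq> 1"
  proof
    assume "q = 1"
    then have "cos (2 * pi * (real k - real l) / real N) = 1"
      by (simp add: q_def complex_eq_iff)
    then obtain n :: int where "2 * pi * (real k - real l) / real N = of_int n * 2 * pi"
      by (auto simp: cos_one_2pi_int)
    then have "(2 * pi) * ((real k - real l) / real N) = (2 * pi) * of_int n"
      by (simp add: mult_ac)
    then have "(real k - real l) / real N = of_int n"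
      unfolding mult_cancel_left by simp
    then have "real k - real l = of_int n * real N"
      using assms(1) by (simp add: divide_eq_eq)
    then have "real_of_int (int k - int l) = real_of_int (n * int N)"
      by simp
    then have "int k - int l = n * int N"
      by (simp only: of_int_eq_iff)
    then have "int N dvd int k - int l"
      by simp
    then have "int k mod int N = int l mod int N"
      by (simp add: mod_eq_dvd_iff)
    then show False
      using assms False by simp
  qed
  ultimately show ?thesis
    using False by (simp add: geometric_sum)
qed

text \<open>Discrete Fourier inversion expresses each coefficient as an average of values of
  \<open>F\<close> with unimodular weights, so its norm is at most \<open>B\<close>. Powers of
  \<open>c\<close> preserve norms, and there are \<open>d + 1\<close> terms.\<close>

lemma norm_poly_rep_crude:
  assumes c: "central_unitary c" and "poly_rep c d F T"
    and B: "\<And>z. cmod z = 1 \<Longrightarrow> norm (F z) \<le> B"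
  shows "norm T \<le> real (d + 1) * B"
proof -
  obtain y where y: "T = (\<Sum>j\<le>d. c ^ j * y j)" "\<forall>z. cmod z = 1 \<longrightarrow> F z = (\<Sum>j\<le>d. z ^ j *\<^sub>C y j)"
    using assms(2) unfolding poly_rep_def by blast
  \<comment> \<open>Orthogonality of the roots applies to exponents below \<open>N\<close>, and here
    they run from 0 to \<open>d\<close>.\<close>
  define N where "N = d + 1"
  define w where "w = (\<lambda>m. cis (2 * pi * real m / real N))"
  have w: "cmod (w m) = 1" for m
    by (simp add: w_def)
  have "norm (y k) \<le> B" if k: "k \<le> d" for k
  proof -
    have "(\<Sum>m<N. cnj (w m) ^ k *\<^sub>C F (w m)) = (\<Sum>m<N. \<Sum>j\<le>d. (w m ^ j * cnj (w m) ^ k) *\<^sub>C y j)"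
      using w y(2) by (simp add: scaleC_sum_right scaleC_scaleC mult.commute)
    also have "\<dots> = (\<Sum>j\<le>d. (\<Sum>m<N. w m ^ j * cnj (w m) ^ k) *\<^sub>C y j)"
      by (subst sum.swap) (simp add: scaleC_sum_left)
    also have "\<dots> = (\<Sum>j\<le>d. if j = k then of_nat N *\<^sub>C y j else 0)"
      using sum_roots_of_unity_power[of _ N k] k by (intro sum.cong) (auto simp: N_def w_def)
    also have "\<dots> = of_nat N *\<^sub>C y k"
      using k by simp
    finally have "real N * norm (y k) = norm (\<Sum>m<N. cnj (w m) ^ k *\<^sub>C F (w m))"
      by (simp add: norm_scaleC)
    also have "\<dots> \<le> (\<Sum>m<N. norm (cnj (w m) ^ k *\<^sub>C F (w m)))"
      by (rule norm_sum)
    also have "\<dots> \<le> (\<Sum>m<N. B)"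
      using B w by (intro sum_mono) (simp add: norm_scaleC norm_power)
    finally show ?thesis
      by (simp add: N_def)
  qed
  then have "norm (c ^ k * y k) \<le> B" if "k \<le> d" for k
    using that norm_central_unitary_mult[OF central_unitary_power[OF c]] by simp
  then have "norm T \<le> (\<Sum>j\<le>d. B)"
    unfolding y(1) by (intro sum_norm_le) auto
  then show ?thesis
    by simp
qed

text \<open>Passing from \<open>T\<close> to \<open>c\<^sup>d T\<^sup>* T\<close> squares the norm and the bound but only doubles the degree, so the
  factor \<open>d + 1\<close> of the crude estimate disappears in the limit.\<close>

lemma norm_poly_rep_power:
  assumes c: "central_unitary c" and "poly_rep c d F T"
    and B: "\<And>z. cmod z = 1 \<Longrightarrow> norm (F z) \<le> B"
  shows "norm T ^ (2 ^ m) \<le> real (2 ^ m * d + 1) * B ^ (2 ^ m)"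
  using assms(2,3)
proof (induction m arbitrary: d F T B)
  case 0
  then show ?case
    using norm_poly_rep_crude[OF c, of d F T B] by simp
next
  case (Suc m)
  have B: "0 \<le> B"
    using order_trans[OF norm_ge_zero Suc.prems(2)[of 1]] by simp
  define S where "S = c ^ d * star T * T"
  have "poly_rep c (d + d) (\<lambda>z. z ^ d *\<^sub>C star (F z) * F z) S"
    unfolding S_def by (intro poly_rep_mult poly_rep_star c Suc.prems(1))
  moreover have "norm (z ^ d *\<^sub>C star (F z) * F z) \<le> B\<^sup>2" if "cmod z = 1" for z
    using Suc.prems(2)[OF that] that
    by (simp add: mult_scaleC_left norm_scaleC norm_power cstar_identity power_mono)
  ultimately have "norm S ^ (2 ^ m) \<le> real (2 ^ m * (d + d) + 1) * (B\<^sup>2) ^ (2 ^ m)"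
    by (rule Suc.IH)
  moreover have "norm S = (norm T)\<^sup>2"
    unfolding S_def mult.assoc
    by (simp add: norm_central_unitary_mult[OF central_unitary_power[OF c]] cstar_identity)
  moreover have "2 ^ m * (d + d) = 2 ^ Suc m * d"
    by simp
  ultimately show ?case
    by (simp only: power_mult[symmetric] power_Suc)
qed

text \<open>If \<open>norm T\<close> exceeded \<open>B\<close>, the powers of a ratio
  \<open>r > 1\<close> at the exponents \<open>2 ^ m\<close> would stay below a linear function of
  \<open>2 ^ m\<close>, against exponential growth.\<close>

lemma norm_poly_rep_le:
  assumes c: "central_unitary c" and "poly_rep c d F T"
    and B: "\<And>z. cmod z = 1 \<Longrightarrow> norm (F z) \<le> B"
  shows "norm T \<le> B"
proof (rule ccontr)
  assume less: "\<not> norm T \<le> B"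
  have B0: "0 \<le> B"
    using order_trans[OF norm_ge_zero B[of 1]] by simp
  \<comment> \<open>For \<open>B = 0\<close> there is no ratio to form, but the crude estimate
    already gives \<open>norm T \<le> 0\<close>.\<close>
  have "B \<noteq> 0"
    using norm_poly_rep_crude[OF assms] less by auto
  with B0 have pos: "0 < B"
    by simp
  define r where "r = norm T / B"
  have r: "1 < r"
    using less pos by (simp add: r_def)
  have bound: "r ^ (2 ^ m) \<le> real (2 ^ m * d + 1)" for m
    using norm_poly_rep_power[OF assms, of m] pos
    by (simp add: r_def power_divide divide_le_eq)
  have "(\<lambda>n. (real n * real d + 1) / r ^ n) \<longlonglongrightarrow> 0"
  proof -
    have "(\<lambda>n. real d * (real n * inverse r ^ n) + inverse r ^ n) \<longlonglongrightarrow> real d * 0 + 0"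
      using r by (intro tendsto_intros powser_times_n_limit_0 LIMSEQ_realpow_zero) (auto simp: inverse_less_1_iff)
    then show ?thesis
      by (simp add: field_simps add_divide_distrib)
  qed
  then have "eventually (\<lambda>n. (real n * real d + 1) / r ^ n < 1) sequentially"
    by (rule order_tendstoD) simp
  then obtain n0 where n0: "\<And>n. n \<ge> n0 \<Longrightarrow> (real n * real d + 1) / r ^ n < 1"
    unfolding eventually_sequentially by blast
  \<comment> \<open>The inequality holds from \<open>n0\<close> on; \<open>2 ^ n0\<close> is a later
    index, and of the form that \<open>bound\<close> covers.\<close>
  have "(real (2 ^ n0) * real d + 1) / r ^ (2 ^ n0) < 1"
    by (intro n0 less_imp_le less_exp)
  then show False
    using bound[of n0] r by (simp add: divide_less_eq)
qed

section \<open>Fejer kernels on the circle\<close>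

text \<open>\<open>cnj (g m) * g m\<close> is \<open>1 / N\<close> times the Fejer kernel centred at
  \<open>w m\<close>. Orthogonality of the roots gives total mass 1. For the centre,
  \<open>(w m - z) * g m\<close> telescopes to a term of modulus at most
  \<open>2 / N\<close>.\<close>

lemma fejer_partition_scalar:
  fixes N :: nat
  assumes N: "0 < N" and z: "cmod z = 1"
  defines "w \<equiv> \<lambda>m. cis (2 * pi * real m / real N)"
  defines "g \<equiv> \<lambda>m. (\<Sum>k<N. (cnj (w m) * z) ^ k) / of_nat N"
  shows "(\<Sum>m<N. cnj (g m) * g m) = 1"
    and "cmod ((\<Sum>m<N. w m * (cnj (g m) * g m)) - z) \<le> 2 / real N"
proof -
  have w: "cmod (w m) = 1" for m
    by (simp add: w_def)
  have zz: "z * cnj z = 1"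
    using z by (simp add: complex_norm_square[symmetric])
  have ww: "w m * cnj (w m) = 1" for m
    using w by (simp add: complex_norm_square[symmetric])
  have cg: "cnj (g m) = (\<Sum>k<N. w m ^ k * cnj z ^ k) / of_nat N" for m
    by (simp add: g_def power_mult_distrib)
  \<comment> \<open>As a function of \<open>w m\<close>, \<open>cnj (g m)\<close> is a polynomial of
    degree below \<open>N\<close>; the sum is its discrete Fourier transform and isolates one
    coefficient.\<close>
  have orth: "(\<Sum>m<N. cnj (g m) * cnj (w m) ^ l) = cnj z ^ l" if l: "l < N" for l
  proof -
    have "(\<Sum>m<N. cnj (g m) * cnj (w m) ^ l)
        = (\<Sum>m<N. \<Sum>k<N. (w m ^ k * cnj (w m) ^ l) * (cnj z ^ k / of_nat N))"
      by (simp add: cg sum_distrib_right sum_distrib_left sum_divide_distrib mult_ac)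
    also have "\<dots> = (\<Sum>k<N. (\<Sum>m<N. w m ^ k * cnj (w m) ^ l) * (cnj z ^ k / of_nat N))"
      by (subst sum.swap) (simp only: sum_distrib_right)
    also have "\<dots> = (\<Sum>k<N. if k = l then cnj z ^ k else 0)"
      using sum_roots_of_unity_power[of _ N l] l N by (intro sum.cong) (auto simp: w_def)
    finally show ?thesis
      using l by simp
  qed
  have "(\<Sum>m<N. cnj (g m) * g m) = (\<Sum>m<N. \<Sum>l<N. cnj (g m) * cnj (w m) ^ l * (z ^ l / of_nat N))"
    by (subst (2) g_def) (simp add: sum_distrib_left sum_divide_distrib power_mult_distrib mult_ac)
  also have "\<dots> = (\<Sum>l<N. (\<Sum>m<N. cnj (g m) * cnj (w m) ^ l) * (z ^ l / of_nat N))"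
    by (subst sum.swap) (simp only: sum_distrib_right)
  also have "\<dots> = (\<Sum>l<N. 1 / of_nat N)"
    using zz by (intro sum.cong) (auto simp: orth power_mult_distrib[symmetric] mult.commute)
  finally show one: "(\<Sum>m<N. cnj (g m) * g m) = 1"
    using N by simp
  have wN: "w m ^ N = 1" for m
  proof -
    have "w m ^ N = cis (2 * pi * real_of_int (int m))"
      using N by (simp add: w_def Complex.DeMoivre)
    then show ?thesis
      by (simp only: cis_multiple_2pi Ints_of_int)
  qed
  \<comment> \<open>The geometric sum telescopes, and \<open>w m ^ N = 1\<close> removes
    \<open>w m\<close> from the \<open>N\<close>-th power.\<close>
  have shift: "(w m - z) * g m = w m * ((1 - z ^ N) / of_nat N)" for m
  proof -
    have "w m * ((1 - cnj (w m) * z) * g m) = w m * ((1 - (cnj (w m) * z) ^ N) / of_nat N)"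
      by (simp add: g_def one_diff_power_eq)
    moreover have "(cnj (w m) * z) ^ N = z ^ N"
      using wN[of m] by (simp add: power_mult_distrib flip: complex_cnj_power)
    moreover have "w m * ((1 - cnj (w m) * z) * g m) = (w m - (w m * cnj (w m)) * z) * g m"
      by (simp add: algebra_simps)
    ultimately show ?thesis
      by (simp add: ww)
  qed
  \<comment> \<open>The weight \<open>w m\<close> becomes a power with exponent
    \<open>N - 1\<close>, the largest that \<open>orth\<close> admits.\<close>
  have last: "cnj (w m) ^ (N - 1) = w m" for m
  proof -
    have "cnj (w m) ^ (N - 1) = cnj (w m) ^ (N - 1) * cnj (w m) * w m"
      using ww[of m] by (simp add: mult_ac)
    also have "cnj (w m) ^ (N - 1) * cnj (w m) = cnj (w m ^ N)"
      by (simp only: power_minus_mult[OF N] complex_cnj_power)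
    finally show ?thesis
      by (simp add: wN)
  qed
  have "(\<Sum>m<N. w m * (cnj (g m) * g m)) - z = (\<Sum>m<N. w m * (cnj (g m) * g m)) - z * (\<Sum>m<N. cnj (g m) * g m)"
    by (simp add: one)
  also have "\<dots> = (\<Sum>m<N. cnj (g m) * ((w m - z) * g m))"
    by (simp add: sum_distrib_left sum_subtractf[symmetric] algebra_simps)
  also have "\<dots> = (\<Sum>m<N. cnj (g m) * cnj (w m) ^ (N - 1)) * ((1 - z ^ N) / of_nat N)"
    by (simp only: shift last sum_distrib_right mult.assoc)
  also have "\<dots> = cnj z ^ (N - 1) * ((1 - z ^ N) / of_nat N)"
    using N by (simp add: orth)
  finally have "cmod ((\<Sum>m<N. w m * (cnj (g m) * g m)) - z) = cmod (1 - z ^ N) / real N"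
    using z by (simp add: norm_mult norm_power norm_divide)
  also have "\<dots> \<le> 2 / real N"
    using norm_triangle_ineq4[of 1 "z ^ N"] z by (simp add: norm_power divide_right_mono)
  finally show "cmod ((\<Sum>m<N. w m * (cnj (g m) * g m)) - z) \<le> 2 / real N" .
qed

section \<open>Fejer kernels evaluated at a central unitary\<close>

text \<open>\<open>f m\<close> is the Fejer kernel at \<open>w m\<close>, evaluated at
  \<open>c\<close>. The properties of \<open>f\<close> are checked on the circle and transferred by
  \<open>norm_poly_rep_le\<close>. The last one takes the place of positivity: at each
  \<open>z\<close> the kernel values are convex weights.\<close>

lemma central_unitary_partition:
  fixes c :: "'a::unital_cstar_algebra"
  assumes c: "central_unitary c" and N: "0 < N"
  obtains w :: "nat \<Rightarrow> complex" and f :: "nat \<Rightarrow> 'a"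
  where "\<And>m. cmod (w m) = 1" "(\<Sum>m<N. f m) = 1"
    "norm ((\<Sum>m<N. w m *\<^sub>C f m) - c) \<le> 2 / real N"
    "\<forall>x B. (\<forall>m<N. norm (x m) \<le> B) \<longrightarrow> norm (\<Sum>m<N. f m * x m) \<le> B"
proof -
  define w where "w = (\<lambda>m. cis (2 * pi * real m / real N))"
  define g where "g = (\<lambda>m z. (\<Sum>k<N. (cnj (w m) * z) ^ k) / of_nat N)"
  define p where "p = (\<lambda>m z. cnj (g m z) * g m z)"
  define D where "D = N - 1"
  \<comment> \<open>The Fejer kernels are Laurent polynomials; the factor \<open>c ^ D\<close> clears the negative exponents.\<close>
  define G where "G = (\<lambda>m. \<Sum>k<N. c ^ k * ((cnj (w m) ^ k / of_nat N) *\<^sub>C 1))"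
  define H where "H = (\<lambda>m. c ^ D * star (G m) * G m)"
  define f where "f = (\<lambda>m. star c ^ D * H m)"
  have p_sum: "(\<Sum>m<N. p m z) = 1"
    and p_centre: "cmod ((\<Sum>m<N. w m * p m z) - z) \<le> 2 / real N" if "cmod z = 1" for z
    using fejer_partition_scalar[OF N that] unfolding p_def g_def w_def by auto
  have G: "poly_rep c D (\<lambda>z. g m z *\<^sub>C 1) (G m)" for m
  proof -
    have "poly_rep c D (\<lambda>z. \<Sum>k<N. z ^ k *\<^sub>C ((cnj (w m) ^ k / of_nat N) *\<^sub>C 1)) (G m)"
      unfolding G_def by (intro poly_rep_sum poly_rep_monomial) (auto simp: D_def)
    then show ?thesis
      by (rule poly_rep_cong)
        (auto simp: g_def scaleC_scaleC scaleC_sum_left[symmetric] sum_divide_distrib power_mult_distrib mult_ac)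
  qed
  have H: "poly_rep c (D + D) (\<lambda>z. (z ^ D * p m z) *\<^sub>C 1) (H m)" for m
  proof -
    have "poly_rep c (D + D) (\<lambda>z. z ^ D *\<^sub>C star (g m z *\<^sub>C 1) * (g m z *\<^sub>C 1)) (H m)"
      unfolding H_def by (intro poly_rep_mult poly_rep_star c G)
    then show ?thesis
      by (rule poly_rep_cong)
        (auto simp: p_def star_scaleC star_one scaleC_scaleC mult_scaleC_left mult_scaleC_right mult_ac)
  qed
  have cD: "central_unitary (star c ^ D)"
    by (intro central_unitary_power central_unitary_star c)
  have inv: "star c ^ D * c ^ D = 1"
    using central_unitaryD(2)[OF central_unitary_power[OF c, of D]] by (simp add: star_power)
  show ?thesis
  proof
    show "cmod (w m) = 1" for m
      by (simp add: w_def)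
    show "\<forall>x B. (\<forall>m<N. norm (x m) \<le> B) \<longrightarrow> norm (\<Sum>m<N. f m * x m) \<le> B"
    proof (intro allI impI)
      fix x :: "nat \<Rightarrow> 'a" and B :: real
      assume x: "\<forall>m<N. norm (x m) \<le> B"
      have "poly_rep c (D + D + 0) (\<lambda>z. \<Sum>m<N. (z ^ D * p m z) *\<^sub>C 1 * x m) (\<Sum>m<N. H m * x m)"
        by (intro poly_rep_sum poly_rep_mult c H poly_rep_const)
      moreover have "norm (\<Sum>m<N. (z ^ D * p m z) *\<^sub>C 1 * x m) \<le> B" if z: "cmod z = 1" for z
      proof -
        \<comment> \<open>The weights \<open>p m z\<close> are nonnegative with sum 1, and
          \<open>z ^ D\<close> has modulus 1, so the sum is bounded like a convex
          combination.\<close>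
        have "complex_of_real (\<Sum>m<N. (cmod (g m z))\<^sup>2) = (\<Sum>m<N. p m z)"
          unfolding p_def of_real_sum
          by (intro sum.cong) (simp_all only: complex_norm_square mult.commute)
        then have one: "(\<Sum>m<N. (cmod (g m z))\<^sup>2) = 1"
          unfolding p_sum[OF z] of_real_eq_1_iff .
        have "norm (\<Sum>m<N. (z ^ D * p m z) *\<^sub>C 1 * x m) \<le> (\<Sum>m<N. (cmod (g m z))\<^sup>2 * B)"
          using x z
          by (intro sum_norm_le)
            (simp add: mult_scaleC_left norm_scaleC norm_mult norm_power p_def power2_eq_square mult_left_mono)
        then show ?thesis
          by (simp add: sum_distrib_right[symmetric] one)
      qed
      ultimately have "norm (\<Sum>m<N. H m * x m) \<le> B"
        by (rule norm_poly_rep_le[OF c])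
      moreover have "(\<Sum>m<N. f m * x m) = star c ^ D * (\<Sum>m<N. H m * x m)"
        by (simp add: f_def sum_distrib_left mult.assoc)
      ultimately show "norm (\<Sum>m<N. f m * x m) \<le> B"
        by (simp add: norm_central_unitary_mult[OF cD])
    qed
    show "(\<Sum>m<N. f m) = 1"
    proof -
      \<comment> \<open>The identity is obtained as an estimate with bound 0: the difference of
        \<open>\<Sum>m<N. H m\<close> and \<open>c ^ D\<close> comes from a polynomial that vanishes
        on the circle.\<close>
      have "poly_rep c (D + D) (\<lambda>z. z ^ D *\<^sub>C (- 1)) (c ^ D * (- 1))"
        by (intro poly_rep_monomial) auto
      moreover have "poly_rep c (D + D) (\<lambda>z. \<Sum>m<N. (z ^ D * p m z) *\<^sub>C 1) (\<Sum>m<N. H m)"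
        by (intro poly_rep_sum H)
      ultimately have "poly_rep c (D + D) (\<lambda>z. (\<Sum>m<N. (z ^ D * p m z) *\<^sub>C 1) + z ^ D *\<^sub>C (- 1))
          ((\<Sum>m<N. H m) + c ^ D * (- 1))"
        by (intro poly_rep_add)
      moreover have "norm ((\<Sum>m<N. (z ^ D * p m z) *\<^sub>C 1) + z ^ D *\<^sub>C (- 1::'a)) \<le> 0"
        if "cmod z = 1" for z
      proof -
        have "(\<Sum>m<N. (z ^ D * p m z) *\<^sub>C 1) = z ^ D *\<^sub>C (1::'a)"
          by (simp add: scaleC_sum_left[symmetric] sum_distrib_left[symmetric] p_sum[OF that])
        then show ?thesis
          by (simp add: scaleC_add_right[symmetric])
      qed
      ultimately have "norm ((\<Sum>m<N. H m) + c ^ D * (- 1)) \<le> 0"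
        by (rule norm_poly_rep_le[OF c])
      then have "(\<Sum>m<N. H m) = c ^ D"
        by simp
      then show ?thesis
        by (simp add: f_def sum_distrib_left[symmetric] inv)
    qed
    show "norm ((\<Sum>m<N. w m *\<^sub>C f m) - c) \<le> 2 / real N"
    proof -
      \<comment> \<open>The exponent \<open>D + 1\<close> is that of \<open>c\<close> times the
        clearing factor \<open>c ^ D\<close>. For \<open>N = 1\<close> it exceeds
        \<open>D + D = 0\<close>, hence the extra 1 in the degree.\<close>
      have "poly_rep c (D + D + 1) (\<lambda>z. z ^ (D + 1) *\<^sub>C (- 1)) (c ^ (D + 1) * (- 1))"
        by (intro poly_rep_monomial) auto
      moreover have "poly_rep c (D + D + 1) (\<lambda>z. \<Sum>m<N. w m *\<^sub>C (z ^ D * p m z) *\<^sub>C 1) (\<Sum>m<N. w m *\<^sub>C H m)"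
        by (intro poly_rep_sum poly_rep_mono[OF poly_rep_scaleC[OF c H]]) simp
      ultimately have "poly_rep c (D + D + 1)
          (\<lambda>z. (\<Sum>m<N. w m *\<^sub>C (z ^ D * p m z) *\<^sub>C 1) + z ^ (D + 1) *\<^sub>C (- 1))
          ((\<Sum>m<N. w m *\<^sub>C H m) + c ^ (D + 1) * (- 1))"
        by (intro poly_rep_add)
      moreover have "norm ((\<Sum>m<N. w m *\<^sub>C (z ^ D * p m z) *\<^sub>C 1) + z ^ (D + 1) *\<^sub>C (- 1::'a)) \<le> 2 / real N"
        if z: "cmod z = 1" for z
      proof -
        have "z ^ (D + 1) *\<^sub>C (- 1::'a) = - (z ^ (D + 1)) *\<^sub>C 1"
          using scaleC_add_right[of "z ^ (D + 1)" "- 1" "1::'a"]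
          by (simp add: scaleC_minus_left eq_neg_iff_add_eq_0)
        then have "(\<Sum>m<N. w m *\<^sub>C (z ^ D * p m z) *\<^sub>C 1) + z ^ (D + 1) *\<^sub>C (- 1::'a)
            = (z ^ D * ((\<Sum>m<N. w m * p m z) - z)) *\<^sub>C 1"
          by (simp add: scaleC_scaleC scaleC_minus_left scaleC_diff_left right_diff_distrib
              sum_distrib_left scaleC_sum_left mult_ac)
        then show ?thesis
          using p_centre[OF z] z by (simp add: norm_scaleC norm_mult norm_power)
      qed
      ultimately have "norm ((\<Sum>m<N. w m *\<^sub>C H m) + c ^ (D + 1) * (- 1)) \<le> 2 / real N"
        by (rule norm_poly_rep_le[OF c])
      moreover have "(\<Sum>m<N. w m *\<^sub>C f m) - c = star c ^ D * ((\<Sum>m<N. w m *\<^sub>C H m) + c ^ (D + 1) * (- 1))"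
      proof -
        have "star c ^ D * c ^ (D + 1) = c"
          using inv by (metis Suc_eq_plus1 mult.assoc mult_1_left power_Suc2)
        then show ?thesis
          by (simp add: f_def sum_distrib_left mult_scaleC_right right_diff_distrib)
      qed
      ultimately show ?thesis
        by (simp add: norm_central_unitary_mult[OF cD])
    qed
  qed
qed

section \<open>States composed with the partition\<close>

lemma stateD:
  assumes "\<phi> \<in> states"
  shows "bounded_linear \<phi>" "\<phi> (a *\<^sub>C x) = a * \<phi> x" "\<phi> 1 = 1" "cmod (\<phi> x) \<le> norm x"
  using assms onorm[of \<phi> x] by (auto simp: states_def dual_space_def)

lemma stateI:
  assumes "bounded_linear \<phi>" "\<And>a x. \<phi> (a *\<^sub>C x) = a * \<phi> x" "\<phi> 1 = 1" "\<And>x. cmod (\<phi> x) \<le> norm x"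
  shows "\<phi> \<in> states"
proof -
  have "onorm \<phi> \<le> 1"
    using assms(4) by (intro onorm_bound) auto
  moreover have "1 \<le> onorm \<phi>"
    using onorm[OF assms(1), of 1] assms(3) by simp
  ultimately show ?thesis
    using assms by (auto simp: states_def dual_space_def)
qed

lemma norm_state_le_numerical_radius:
  assumes "\<phi> \<in> states"
  shows "cmod (\<phi> x) \<le> numerical_radius x"
  unfolding numerical_radius_def
  using stateD(4) assms by (intro cSUP_upper bdd_aboveI2[of _ _ "norm x"]) auto

lemma exists_phase: "\<exists>u. cmod u = 1 \<and> u * s = complex_of_real (cmod s)"
proof (cases "s = 0")
  case False
  then show ?thesis
    by (intro exI[of _ "cnj s / of_real (cmod s)"])
      (simp add: norm_divide power2_eq_square divide_eq_eq mult.commute flip: complex_norm_square)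
qed (auto intro: exI[of _ 1])

text \<open>A state is a functional of norm 1 with value 1 at the unit. So
  \<open>\<phi> (f m * y)\<close>, as a functional of \<open>y\<close>, becomes a state after
  division by its value \<open>a m\<close> at 1, once its norm is bounded by
  \<open>cmod (a m)\<close>; \<open>contr\<close>, \<open>unit\<close> and \<open>scaled\<close>
  provide this bound.\<close>

lemma norm_state_central_unitary_le:
  fixes x :: "'a::unital_cstar_algebra"
  assumes \<phi>: "\<phi> \<in> states" and c: "central_unitary c" and N: "0 < N"
  shows "cmod (\<phi> (c * x)) \<le> numerical_radius x + 2 / real N * norm x"
proof -
  obtain w :: "nat \<Rightarrow> complex" and f :: "nat \<Rightarrow> 'a" where w: "\<And>m. cmod (w m) = 1"
    and f_sum: "(\<Sum>m<N. f m) = 1"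
    and f_centre: "norm ((\<Sum>m<N. w m *\<^sub>C f m) - c) \<le> 2 / real N"
    and f_bound: "\<forall>x B. (\<forall>m<N. norm (x m) \<le> B) \<longrightarrow> norm (\<Sum>m<N. f m * x m) \<le> B"
    using central_unitary_partition[OF c N] by blast
  interpret \<phi>: bounded_linear \<phi>
    by (rule stateD(1)[OF \<phi>])
  \<comment> \<open>Multiplying each \<open>y m\<close> by a phase makes every term nonnegative, so
    the sum of moduli is the value of \<open>\<phi>\<close> at a single element, which
    \<open>f_bound\<close> controls.\<close>
  have contr: "(\<Sum>m<N. cmod (\<phi> (f m * y m))) \<le> B" if y: "\<And>m. m < N \<Longrightarrow> norm (y m) \<le> B" for y B
  proof -
    have "\<forall>m. \<exists>u. cmod u = 1 \<and> u * \<phi> (f m * y m) = of_real (cmod (\<phi> (f m * y m)))"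
      by (intro allI exists_phase)
    then obtain u where u: "\<And>m. cmod (u m) = 1"
        "\<And>m. u m * \<phi> (f m * y m) = of_real (cmod (\<phi> (f m * y m)))"
      by (auto dest!: choice)
    have eq: "complex_of_real (\<Sum>m<N. cmod (\<phi> (f m * y m))) = \<phi> (\<Sum>m<N. f m * (u m *\<^sub>C y m))"
      by (simp add: \<phi>.sum mult_scaleC_right stateD(2)[OF \<phi>] u)
    have "(\<Sum>m<N. cmod (\<phi> (f m * y m))) \<le> cmod (complex_of_real (\<Sum>m<N. cmod (\<phi> (f m * y m))))"
      unfolding norm_of_real by (rule abs_ge_self)
    also have "\<dots> \<le> norm (\<Sum>m<N. f m * (u m *\<^sub>C y m))"
      unfolding eq by (rule stateD(4)[OF \<phi>])
    also have "\<dots> \<le> B"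
      using y u by (intro f_bound[rule_format]) (simp add: norm_scaleC)
    finally show ?thesis .
  qed
  define a where "a = (\<lambda>m. \<phi> (f m))"
  have a_sum: "(\<Sum>m<N. a m) = 1"
    using stateD(3)[OF \<phi>] by (simp add: a_def f_sum flip: \<phi>.sum)
  have a_le: "(\<Sum>m<N. cmod (a m)) \<le> 1"
    using contr[of "\<lambda>_. 1" 1] by (simp add: a_def)
  \<comment> \<open>Since the \<open>a k\<close> sum to 1, testing \<open>contr\<close> on the family with \<open>y\<close> in place \<open>m\<close> and 1 elsewhere leaves
    no more than \<open>cmod (a m)\<close> for the term at \<open>m\<close>.\<close>
  have unit: "cmod (\<phi> (f m * y)) \<le> cmod (a m)" if m: "m < N" and y: "norm y \<le> 1" for m y
  proof -
    have "1 \<le> (\<Sum>m<N. cmod (a m))"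
      using norm_sum[of a "{..<N}"] a_sum by simp
    also have "\<dots> = cmod (a m) + (\<Sum>k\<in>{..<N} - {m}. cmod (a k))"
      using m by (intro sum.remove) auto
    finally have "1 \<le> cmod (a m) + (\<Sum>k\<in>{..<N} - {m}. cmod (a k))" .
    moreover have "(\<Sum>k<N. cmod (\<phi> (f k * (if k = m then y else 1)))) \<le> 1"
      using y by (intro contr) auto
    moreover have "(\<Sum>k<N. cmod (\<phi> (f k * (if k = m then y else 1))))
        = cmod (\<phi> (f m * y)) + (\<Sum>k\<in>{..<N} - {m}. cmod (a k))"
      using m by (subst sum.remove[of _ m]) (auto simp: a_def)
    ultimately show ?thesis
      by linarith
  qed
  have scaled: "cmod (\<phi> (f m * y)) \<le> cmod (a m) * norm y" if m: "m < N" for m y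
  proof (cases "y = 0")
    case False
    have "cmod (\<phi> (f m * (y /\<^sub>R norm y))) \<le> cmod (a m)"
      using m False by (intro unit) auto
    then show ?thesis
      using False by (simp add: \<phi>.scaleR field_simps)
  qed simp
  have radius: "cmod (\<phi> (f m * x)) \<le> cmod (a m) * numerical_radius x" if m: "m < N" for m
  \<comment> \<open>A zero weight cannot be normalized, but then \<open>scaled\<close> makes the
    whole functional vanish.\<close>
  proof (cases "a m = 0")
    case True
    then show ?thesis
      using scaled[OF m, of x] by simp
  next
    case False
    have "(\<lambda>y. \<phi> (f m * y) / a m) \<in> states"
    proof (rule stateI)
      show "bounded_linear (\<lambda>y. \<phi> (f m * y) / a m)"
        by (rule bounded_linear_compose[OF bounded_linear_divide
              bounded_linear_compose[OF stateD(1)[OF \<phi>] bounded_linear_mult_right]])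
      show "\<phi> (f m * (b *\<^sub>C y)) / a m = b * (\<phi> (f m * y) / a m)" for b y
        by (simp add: mult_scaleC_right stateD(2)[OF \<phi>])
      show "\<phi> (f m * 1) / a m = 1"
        using False by (simp add: a_def)
      show "cmod (\<phi> (f m * y) / a m) \<le> norm y" for y
        using scaled[OF m, of y] False by (simp add: norm_divide divide_le_eq mult.commute)
    qed
    from norm_state_le_numerical_radius[OF this, of x] show ?thesis
      using False by (simp add: norm_divide divide_le_eq mult.commute)
  qed
  have v0: "0 \<le> numerical_radius x"
    using norm_state_le_numerical_radius[OF \<phi>, of x] norm_ge_zero[of "\<phi> x"] by linarith
  \<comment> \<open>\<open>E\<close> approximates \<open>c\<close>: its contribution is a
    combination of state values at \<open>x\<close>, and \<open>E - c\<close> leaves the error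
    term.\<close>
  define E where "E = (\<Sum>m<N. w m *\<^sub>C f m)"
  have "cmod (\<phi> (E * x)) \<le> (\<Sum>m<N. cmod (a m) * numerical_radius x)"
    unfolding E_def sum_distrib_right \<phi>.sum using radius w
    by (intro sum_norm_le) (simp add: mult_scaleC_left stateD(2)[OF \<phi>] norm_mult)
  also have "\<dots> \<le> numerical_radius x"
    using mult_right_mono[OF a_le v0] by (simp add: sum_distrib_right)
  finally have "cmod (\<phi> (E * x)) \<le> numerical_radius x" .
  moreover have "cmod (\<phi> ((E - c) * x)) \<le> 2 / real N * norm x"
  proof -
    have "cmod (\<phi> ((E - c) * x)) \<le> norm (E - c) * norm x"
      using stateD(4)[OF \<phi>] norm_mult_ineq order_trans by blast
    also have "\<dots> \<le> 2 / real N * norm x"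
      using f_centre by (intro mult_right_mono) (auto simp: E_def)
    finally show ?thesis .
  qed
  moreover have "\<phi> (c * x) = \<phi> (E * x) - \<phi> ((E - c) * x)"
    by (simp add: left_diff_distrib flip: \<phi>.diff)
  then have "cmod (\<phi> (c * x)) \<le> cmod (\<phi> (E * x)) + cmod (\<phi> ((E - c) * x))"
    by (simp only: norm_triangle_ineq4)
  ultimately show ?thesis
    by linarith
qed

section \<open>Invariance of the numerical radius and of parallelism\<close>

text \<open>If there were no states, both suprema would be \<open>Sup {}\<close>; this case distinction spares the
  Hahn-Banach theorem.\<close>

lemma numerical_radius_central_unitary_mult:
  assumes c: "central_unitary (c::'a::unital_cstar_algebra)"
  shows "numerical_radius (c * x) = numerical_radius x"
proof (cases "states = ({} :: ('a \<Rightarrow> complex) set)")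
  case True
  then show ?thesis
    by (simp add: numerical_radius_def)
next
  case False
  have le: "numerical_radius (d * y) \<le> numerical_radius y" if d: "central_unitary d" for d y :: 'a
    unfolding numerical_radius_def[of "d * y"]
  proof (rule cSUP_least[OF False])
    fix \<phi> :: "'a \<Rightarrow> complex" assume \<phi>: "\<phi> \<in> states"
    \<comment> \<open>With \<open>\<phi>\<close> fixed, refining the partition removes the error
      term.\<close>
    have "(\<lambda>n. numerical_radius y + 2 / real n * norm y) \<longlonglongrightarrow> numerical_radius y + 0 * norm y"
      by (intro tendsto_intros lim_const_over_n)
    moreover have "\<forall>n\<ge>1. cmod (\<phi> (d * y)) \<le> numerical_radius y + 2 / real n * norm y"
      using norm_state_central_unitary_le[OF \<phi> d] by auto
    ultimately show "cmod (\<phi> (d * y)) \<le> numerical_radius y"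
      using LIMSEQ_le_const by fastforce
  qed
  \<comment> \<open>The reverse inequality is \<open>le\<close> for the inverse
    \<open>star c\<close>, which is again a central unitary.\<close>
  have "numerical_radius (star c * (c * x)) \<le> numerical_radius (c * x)"
    by (intro le central_unitary_star c)
  moreover have "star c * (c * x) = x"
    by (simp add: mult.assoc[symmetric] central_unitaryD(2)[OF c])
  ultimately show ?thesis
    using le[OF c, of x] by simp
qed

theorem theorem2p16:
  fixes c :: "'a::unital_cstar_algebra"
  assumes "c \<in> algebra_centre \<inter> unitary_group"
  shows "\<forall>x y. (x \<parallel>\<^sub>v y \<longleftrightarrow> c * x \<parallel>\<^sub>v c * y) \<and>
               (c * x \<parallel>\<^sub>v c * y \<longleftrightarrow> x * c \<parallel>\<^sub>v y * c)"
proof (intro allI conjI)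
  fix x y :: 'a
  \<comment> \<open>Since \<open>c\<close> factors out, the same \<open>\<mu>\<close> serves for
    both pairs.\<close>
  have "c * x + \<mu> *\<^sub>C (c * y) = c * (x + \<mu> *\<^sub>C y)" for \<mu>
    by (simp add: distrib_left mult_scaleC_right)
  then show "x \<parallel>\<^sub>v y \<longleftrightarrow> c * x \<parallel>\<^sub>v c * y"
    by (simp add: numerical_radius_parallel_def numerical_radius_central_unitary_mult[OF assms])
  \<comment> \<open>By centrality both sides speak of the same two elements.\<close>
  show "c * x \<parallel>\<^sub>v c * y \<longleftrightarrow> x * c \<parallel>\<^sub>v y * c"
    by (simp only: central_unitaryD(1)[OF assms, of x] central_unitaryD(1)[OF assms, of y])
qed

end
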